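(* For every positive integer $n$, $$\int_{-1}^{1} \left[ \frac{T_{n}(x) - T_{n}(0)}{x} \right]^{2} \frac{dx}{\sqrt{1-x^{2}}} = \pi n,$$ and $$\int_{-1}^{1} \left[ \frac{U_{n}(x) - U_{n}(0)}{x} \right]^{2} \sqrt{1-x^{2}} \, dx = \begin{cases} \pi n & \text{if } n \text{ is even},\\ \pi (n+1) & \text{if } n \text{ is odd}.\end{cases}$$ Here $T_n$ and $U_n$ are the Chebyshev polynomials of the first and second kind.
   Context: The Chebyshev polynomials of the first kind $T_n$ and of the second kind $U_n$ are defined by $T_n(\cos x)=\cos(nx)$ and $U_n(\cos x)=\dfrac{\sin((n+1)x)}{\sin x}$. *)

theory Defs
  imports "HOL-Analysis.Analysis" "HOL-Computational_Algebra.Polynomial"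
begin

text \<open>The identity for \<open>U\<^sub>n\<close> is required only where \<open>sin x \<noteq> 0\<close>, since division by zero
  yields \<open>0\<close> in HOL. The lemmas below show that both descriptions determine a polynomial uniquely.\<close>

definition cheb_T :: "nat \<Rightarrow> real poly" where
  "cheb_T n = (THE p. \<forall>x. poly p (cos x) = cos (real n * x))"

definition cheb_U :: "nat \<Rightarrow> real poly" where
  "cheb_U n = (THE p. \<forall>x. sin x \<noteq> 0 \<longrightarrow> poly p (cos x) = sin (real (n + 1) * x) / sin x)"

lemma poly_eq_of_cos:
  fixes p q :: "real poly"
  assumes "\<And>x. sin x \<noteq> 0 \<Longrightarrow> poly p (cos x) = poly q (cos x)"
  shows "p = q"
proof (rule ccontr)
  assume "p \<noteq> q"
  then have "finite {y. poly (p - q) y = 0}"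
    by (intro poly_roots_finite) simp
  moreover have "{-1<..<1} \<subseteq> {y. poly (p - q) y = 0}"
  proof
    fix y :: real assume y: "y \<in> {-1<..<1}"
    then have "sin (arccos y) \<noteq> 0"
      by (intro sin_arccos_nonzero) auto
    from assms[OF this] y show "y \<in> {y. poly (p - q) y = 0}"
      by simp
  qed
  ultimately have "finite {-1<..<1::real}"
    by (rule rev_finite_subset)
  then show False
    using infinite_Ioo[of "-1::real" 1] by simp
qed

lemma cheb_T_exists: "\<exists>p. \<forall>x. poly p (cos x) = cos (real n * x)"
proof (induction n rule: less_induct)
  case (less n)
  consider "n = 0" | "n = 1" | m where "n = Suc (Suc m)"
    by (metis One_nat_def not0_implies_Suc)
  then show ?case
  proof cases
    case 1
    then show ?thesis by (intro exI[of _ 1]) simp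
  next
    case 2
    then show ?thesis by (intro exI[of _ "[:0, 1:]"]) simp
  next
    case 3
    obtain p q where p: "\<And>x. poly p (cos x) = cos (real m * x)"
      and q: "\<And>x. poly q (cos x) = cos (real (Suc m) * x)"
      using less.IH[of m] less.IH[of "Suc m"] 3 by auto
    have "poly ([:0, 2:] * q - p) (cos x) = cos (real n * x)" for x
    proof -
      have "cos (real n * x) = cos (real (Suc m) * x + x)"
        and "cos (real m * x) = cos (real (Suc m) * x - x)"
        using 3 by (simp_all add: algebra_simps)
      then have "cos (real n * x) + cos (real m * x) = 2 * cos x * cos (real (Suc m) * x)"
        by (simp only: cos_add cos_diff) simp
      then show ?thesis
        by (simp add: p q del: of_nat_Suc)
    qed
    then show ?thesis by blast
  qed
qed

lemma cheb_U_exists: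
  "\<exists>p. \<forall>x. sin x \<noteq> 0 \<longrightarrow> poly p (cos x) = sin (real (n + 1) * x) / sin x"
proof -
  have "\<exists>p. \<forall>x. sin x * poly p (cos x) = sin (real (n + 1) * x)"
  proof (induction n)
    case 0
    show ?case by (intro exI[of _ 1]) simp
  next
    case (Suc n)
    then obtain p where p: "\<And>x. sin x * poly p (cos x) = sin (real (n + 1) * x)" by blast
    obtain q where q: "\<And>x. poly q (cos x) = cos (real (n + 1) * x)"
      using cheb_T_exists by blast
    have "sin x * poly ([:0, 1:] * p + q) (cos x) = sin (real (Suc n + 1) * x)" for x
    proof -
      have "sin (real (Suc n + 1) * x) = sin (real (n + 1) * x + x)"
        by (simp add: algebra_simps)
      also have "\<dots> = sin x * poly p (cos x) * cos x + poly q (cos x) * sin x"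
        unfolding sin_add p q ..
      finally show ?thesis
        by (simp add: algebra_simps)
    qed
    then show ?case by blast
  qed
  then obtain p where p: "\<And>x. sin x * poly p (cos x) = sin (real (n + 1) * x)" by blast
  have "sin x \<noteq> 0 \<longrightarrow> poly p (cos x) = sin (real (n + 1) * x) / sin x" for x
    using p[of x] by (simp add: field_simps)
  then show ?thesis by blast
qed

lemma cheb_T_cos: "poly (cheb_T n) (cos x) = cos (real n * x)"
proof -
  have "\<exists>!p. \<forall>x. poly p (cos x) = cos (real n * x)"
    using cheb_T_exists[of n] poly_eq_of_cos by (metis (no_types, lifting))
  from theI'[OF this] show ?thesis
    unfolding cheb_T_def by blast
qed

lemma cheb_U_cos:
  assumes "sin x \<noteq> 0"
  shows "poly (cheb_U n) (cos x) = sin (real (n + 1) * x) / sin x"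
proof -
  have "\<exists>!p. \<forall>x. sin x \<noteq> 0 \<longrightarrow> poly p (cos x) = sin (real (n + 1) * x) / sin x"
    using cheb_U_exists[of n] poly_eq_of_cos by (metis (no_types, lifting))
  from theI'[OF this] assms show ?thesis
    unfolding cheb_U_def by blast
qed

end

theory Submission
  imports Defs
begin

text \<open>Write \<open>p\<^sub>n\<close> for \<open>T\<^sub>n\<close> or \<open>U\<^sub>n\<close>, with weight \<open>w / sqrt (1 - x\<^sup>2)\<close> where \<open>w = 1\<close> or
  \<open>w = 1 - x\<^sup>2\<close> respectively. Both families satisfy \<open>p\<^bsub>n+2\<^esub> = 2 x p\<^bsub>n+1\<^esub> - p\<^sub>n\<close>, so adding the
  difference quotients \<open>q\<^sub>n = (p\<^sub>n - p\<^sub>n(0)) / x\<close> at distance two gives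
  \<open>q\<^bsub>n+2\<^esub> + q\<^sub>n = 2 p\<^bsub>n+1\<^esub>\<close>: the values at \<open>0\<close> cancel because the recurrence at \<open>x = 0\<close> reads
  \<open>p\<^bsub>n+2\<^esub>(0) + p\<^sub>n(0) = 0\<close>. Hence \<open>q\<^sub>n\<close> is a combination of \<open>p\<^sub>0, \<dots>, p\<^bsub>n-1\<^esub>\<close> and is orthogonal to
  \<open>p\<^bsub>n+1\<^esub>\<close>. As \<open>p\<^bsub>n+1\<^esub>\<close> has squared norm \<open>\<pi> / 2\<close>, Pythagoras yields
  \<open>\<parallel>q\<^bsub>n+2\<^esub>\<parallel>\<^sup>2 = 4 \<cdot> \<pi> / 2 + \<parallel>q\<^sub>n\<parallel>\<^sup>2 = 2 \<pi> + \<parallel>q\<^sub>n\<parallel>\<^sup>2\<close> (lemma \<open>sqnorm_quot\<close>).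
  The two formulas of the theorem differ only through the starting value for odd \<open>n\<close>: \<open>q\<^sub>0 = 0\<close>
  in both cases, whereas \<open>q\<^sub>1\<close> is \<open>1\<close> with squared norm \<open>\<pi>\<close> for \<open>T\<close>, and \<open>2\<close> with squared norm
  \<open>2 \<pi>\<close> for \<open>U\<close>.

  All integrals are evaluated after the substitution \<open>x = cos \<theta>\<close>
  (lemma \<open>has_integral_arcsine_weight\<close>), which turns orthogonality into that of the functions
  \<open>cos (n \<theta>)\<close>, respectively \<open>sin ((n + 1) \<theta>)\<close>, on \<open>[0, \<pi>]\<close>.\<close>

section \<open>Integration against the arcsine weight\<close>

text \<open>The integral of \<open>p / sqrt (1 - x\<^sup>2)\<close> over \<open>[-1, 1]\<close>, written in the variable \<open>t = arccos x\<close>: here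
  the integrand is continuous, and linearity and orthogonality are immediate.\<close>

definition arcsine_int :: "real poly \<Rightarrow> real" where
  "arcsine_int p = integral {0..pi} (\<lambda>t. poly p (cos t))"

lemma poly_cos_integrable: "(\<lambda>t. poly p (cos t)) integrable_on {0..pi}" for p :: "real poly"
  by (intro integrable_continuous_interval continuous_intros)

text \<open>The arccosine serves as the inner function of the substitution: it is continuous on
  \<open>[-1, 1]\<close>, and its derivative \<open>- 1 / sqrt (1 - x\<^sup>2)\<close>, which produces the weight, may blow up at the
  two end points because the substitution rule admits finitely many exceptional points.\<close>

lemma has_integral_arcsine_weight:
  "((\<lambda>x. poly p x / sqrt (1 - x\<^sup>2)) has_integral arcsine_int p) {-1..1}"
proof -
  have "((\<lambda>x. inverse (- sqrt (1 - x\<^sup>2)) *\<^sub>R poly p (cos (arccos x))) has_integral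
      (integral {arccos (-1)..arccos 1} (\<lambda>t. poly p (cos t))
       - integral {arccos 1..arccos (-1)} (\<lambda>t. poly p (cos t)))) {-1..1}"
  proof (rule has_integral_substitution_general[where s = "{-1, 1}" and c = 0 and d = pi])
    show "(arccos has_real_derivative inverse (- sqrt (1 - x\<^sup>2))) (at x within {-1..1})"
      if "x \<in> {-1..1} - {-1, 1}" for x
      using that by (intro DERIV_subset[OF DERIV_arccos]) auto
  qed (auto intro!: continuous_intros continuous_on_arccos' arccos_lbound arccos_ubound)
  then have neg: "((\<lambda>x. inverse (- sqrt (1 - x\<^sup>2)) * poly p (cos (arccos x))) has_integral
      - arcsine_int p) {-1..1}"
    by (simp add: arcsine_int_def)
  have "((\<lambda>x. - (inverse (- sqrt (1 - x\<^sup>2)) * poly p (cos (arccos x)))) has_integral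
      arcsine_int p) {-1..1}"
    using has_integral_neg[OF neg] by (simp only: minus_minus)
  then show ?thesis
    by (rule has_integral_eq[rotated]) (simp add: divide_inverse)
qed

lemma arcsine_int_add: "arcsine_int (p + q) = arcsine_int p + arcsine_int q"
  by (simp add: arcsine_int_def poly_cos_integrable integral_add)

lemma arcsine_int_diff: "arcsine_int (p - q) = arcsine_int p - arcsine_int q"
  by (simp add: arcsine_int_def poly_cos_integrable integral_diff)

lemma arcsine_int_smult: "arcsine_int (smult c p) = c * arcsine_int p"
  by (simp add: arcsine_int_def)

lemma arcsine_int_0 [simp]: "arcsine_int 0 = 0"
  by (simp add: arcsine_int_def)

lemma arcsine_int_1 [simp]: "arcsine_int 1 = pi"
  by (simp add: arcsine_int_def)

lemma has_integral_cos_multiple: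
  "((\<lambda>t. cos (of_int k * t)) has_integral (if k = 0 then pi else 0)) {0..pi}"
proof (cases "k = 0")
  case True
  then show ?thesis
    using has_integral_const_real[of "1::real" 0 pi] by simp
next
  case False
  have "((\<lambda>t. cos (of_int k * t)) has_integral
      (sin (of_int k * pi) / of_int k - sin (of_int k * 0) / of_int k)) {0..pi}"
    by (rule fundamental_theorem_of_calculus)
       (use False in \<open>auto intro!: derivative_eq_intros
          simp flip: has_real_derivative_iff_has_vector_derivative\<close>)
  moreover have "sin (of_int k * pi) = 0"
    using sin_zero_iff_int2 by blast
  ultimately show ?thesis
    using False by simp
qed

text \<open>Product-to-sum formulas give \<open>s = 1\<close> for products of cosines and \<open>s = -1\<close> for products of
  sines.\<close>

lemma arcsine_int_product:
  assumes "\<And>t. poly p (cos t) = (cos ((real m - real n) * t) + s * cos ((real m + real n) * t)) / 2"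
  shows "arcsine_int p = ((if m = n then pi else 0) + s * (if m + n = 0 then pi else 0)) / 2"
proof -
  have "((\<lambda>t. (cos (of_int (int m - int n) * t) + s * cos (of_int (int m + int n) * t)) / 2)
      has_integral ((if int m - int n = 0 then pi else 0)
        + s * (if int m + int n = 0 then pi else 0)) / 2) {0..pi}"
    by (intro has_integral_divide has_integral_add has_integral_mult_right has_integral_cos_multiple)
  then have "((\<lambda>t. poly p (cos t)) has_integral
      ((if int m - int n = 0 then pi else 0) + s * (if int m + int n = 0 then pi else 0)) / 2) {0..pi}"
    unfolding assms by (simp only: of_int_diff of_int_add of_int_of_nat_eq)
  then have "arcsine_int p =
      ((if int m - int n = 0 then pi else 0) + s * (if int m + int n = 0 then pi else 0)) / 2"
    unfolding arcsine_int_def by (rule integral_unique)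
  then show ?thesis
    by auto
qed

section \<open>Difference quotients in an orthogonal family\<close>

text \<open>The parameters \<open>c\<close> and \<open>w\<close> are what distinguishes the two kinds: \<open>(1, 1)\<close> for the first
  and \<open>(2, 1 - x\<^sup>2)\<close> for the second. The norm of \<open>p 0\<close> is excluded from the normalization
  because it is \<open>\<pi>\<close> rather than \<open>\<pi> / 2\<close> for the first kind.\<close>

locale chebyshev_family =
  fixes p :: "nat \<Rightarrow> real poly" and c :: real and w :: "real poly"
  assumes p_0: "p 0 = 1"
    and p_1: "p (Suc 0) = [:0, c:]"
    and p_rec: "p (Suc (Suc n)) = [:0, 2:] * p (Suc n) - p n"
    and orthogonal: "m \<noteq> n \<Longrightarrow> arcsine_int (w * (p m * p n)) = 0"
    and sqnorm: "arcsine_int (w * (p (Suc n))\<^sup>2) = pi / 2"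
begin

text \<open>Defined without division, so that it is a polynomial by construction; the identification with
  the difference quotient is \<open>quot_eq\<close>.\<close>

fun quot :: "nat \<Rightarrow> real poly" where
  "quot 0 = 0"
| "quot (Suc 0) = [:c:]"
| "quot (Suc (Suc n)) = smult 2 (p (Suc n)) - quot n"

lemma quot_eq: "poly (p n) x - poly (p n) 0 = x * poly (quot n) x"
  by (induction n rule: quot.induct) (auto simp: p_0 p_1 p_rec algebra_simps)

text \<open>By its recursion, \<open>quot n\<close> is a combination of \<open>p 0, \<dots>, p (n - 1)\<close>.\<close>

lemma quot_orthogonal: "n \<le> m \<Longrightarrow> arcsine_int (w * (quot n * p m)) = 0"
proof (induction n rule: quot.induct)
  case 1
  show ?case by simp
next
  case 2
  then have "arcsine_int (w * (p 0 * p m)) = 0"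
    by (intro orthogonal) simp
  then show ?case
    by (simp add: p_0 arcsine_int_smult)
next
  case (3 n)
  have "w * (quot (Suc (Suc n)) * p m) = smult 2 (w * (p (Suc n) * p m)) - w * (quot n * p m)"
    by (simp add: algebra_simps)
  then show ?case
    using 3 orthogonal[of "Suc n" m] by (simp add: arcsine_int_diff arcsine_int_smult)
qed

text \<open>Pythagoras for the two orthogonal summands \<open>2 p (n + 1)\<close> and \<open>- quot n\<close> adds
  \<open>4 \<cdot> \<pi> / 2\<close> at each second step; the parity of \<open>n\<close> decides which of the values at \<open>0\<close> and
  \<open>1\<close> the recursion starts from.\<close>

lemma sqnorm_quot:
  "arcsine_int (w * (quot n)\<^sup>2) =
    (if even n then pi * real n else pi * (real n - 1) + c\<^sup>2 * arcsine_int w)"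
proof (induction n rule: quot.induct)
  case 1
  show ?case by simp
next
  case 2
  show ?case by (simp add: power2_eq_square arcsine_int_smult)
next
  case (3 n)
  have "w * (quot (Suc (Suc n)))\<^sup>2 =
      smult 4 (w * (p (Suc n))\<^sup>2) - smult 4 (w * (quot n * p (Suc n))) + w * (quot n)\<^sup>2"
    by (simp add: power2_eq_square algebra_simps flip: smult_add_left)
  then have "arcsine_int (w * (quot (Suc (Suc n)))\<^sup>2) = 2 * pi + arcsine_int (w * (quot n)\<^sup>2)"
    by (simp add: arcsine_int_add arcsine_int_diff arcsine_int_smult sqnorm quot_orthogonal)
  then show ?case
    by (simp add: 3 algebra_simps)
qed

lemma has_integral_difference_quotient:
  "((\<lambda>x. ((poly (p n) x - poly (p n) 0) / x)\<^sup>2 * (poly w x / sqrt (1 - x\<^sup>2))) has_integral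
    (if even n then pi * real n else pi * (real n - 1) + c\<^sup>2 * arcsine_int w)) {-1..1}"
proof (rule has_integral_spike_finite)
  \<comment> \<open>At \<open>0\<close> the quotient has the value \<open>0\<close> of a division by zero, whatever the value of \<open>quot n\<close>.\<close>
  show "((\<lambda>x. poly (w * (quot n)\<^sup>2) x / sqrt (1 - x\<^sup>2)) has_integral
    (if even n then pi * real n else pi * (real n - 1) + c\<^sup>2 * arcsine_int w)) {-1..1}"
    using has_integral_arcsine_weight[of "w * (quot n)\<^sup>2"] by (simp only: sqnorm_quot)
  show "finite {0::real}" by simp
  show "((poly (p n) x - poly (p n) 0) / x)\<^sup>2 * (poly w x / sqrt (1 - x\<^sup>2))
      = poly (w * (quot n)\<^sup>2) x / sqrt (1 - x\<^sup>2)" if "x \<in> {-1..1} - {0}" for x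
    using that by (simp add: quot_eq)
qed

end

section \<open>The two kinds of Chebyshev polynomials\<close>

lemma cheb_T_eqI:
  assumes "\<And>x. sin x \<noteq> 0 \<Longrightarrow> poly p (cos x) = cos (real n * x)"
  shows "cheb_T n = p"
  by (rule poly_eq_of_cos) (simp add: assms cheb_T_cos)

lemma cheb_U_eqI:
  assumes "\<And>x. sin x \<noteq> 0 \<Longrightarrow> sin x * poly p (cos x) = sin (real (n + 1) * x)"
  shows "cheb_U n = p"
proof (rule poly_eq_of_cos)
  fix x :: real assume "sin x \<noteq> 0"
  then show "poly (cheb_U n) (cos x) = poly p (cos x)"
    using assms[of x] by (simp add: cheb_U_cos nonzero_divide_eq_eq mult.commute)
qed

text \<open>Unlike \<open>cheb_U_cos\<close>, this form has no exceptional points: both sides vanish with \<open>sin x\<close>.\<close>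

lemma sin_times_cheb_U: "sin x * poly (cheb_U n) (cos x) = sin (real (n + 1) * x)"
proof (cases "sin x = 0")
  case True
  then obtain i :: int where "x = of_int i * pi"
    using sin_zero_iff_int2 by blast
  then have "real (n + 1) * x = of_int (int (n + 1) * i) * pi"
    by simp
  then have "sin (real (n + 1) * x) = 0"
    using sin_zero_iff_int2 by blast
  with True show ?thesis by simp
qed (simp add: cheb_U_cos)

interpretation T: chebyshev_family cheb_T 1 1
proof
  show "cheb_T 0 = 1" "cheb_T (Suc 0) = [:0, 1:]"
    by (rule cheb_T_eqI; simp)+
  show "cheb_T (Suc (Suc n)) = [:0, 2:] * cheb_T (Suc n) - cheb_T n" for n
  proof (rule cheb_T_eqI)
    fix x :: real
    have "cos (real (Suc (Suc n)) * x) = cos (real (Suc n) * x + x)"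
      and "cos (real n * x) = cos (real (Suc n) * x - x)"
      by (simp_all add: algebra_simps)
    then show "poly ([:0, 2:] * cheb_T (Suc n) - cheb_T n) (cos x) = cos (real (Suc (Suc n)) * x)"
      by (simp add: cheb_T_cos cos_add cos_diff del: of_nat_Suc)
  qed
  have product: "arcsine_int (1 * (cheb_T m * cheb_T n))
      = ((if m = n then pi else 0) + 1 * (if m + n = 0 then pi else 0)) / 2" for m n
    by (rule arcsine_int_product) (simp add: cheb_T_cos cos_times_cos algebra_simps)
  show "arcsine_int (1 * (cheb_T m * cheb_T n)) = 0" if "m \<noteq> n" for m n
    unfolding product using that by auto
  show "arcsine_int (1 * (cheb_T (Suc n))\<^sup>2) = pi / 2" for n
    unfolding power2_eq_square product by simp
qed

text \<open>The numerator \<open>1 - x\<^sup>2\<close> turns into \<open>sin\<^sup>2 \<theta>\<close> and cancels the denominators of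
  both factors \<open>U\<^sub>m\<close> and \<open>U\<^sub>n\<close>.\<close>

lemma arcsine_int_cheb_U_product:
  "arcsine_int ([:1, 0, -1:] * (cheb_U m * cheb_U n)) = (if m = n then pi / 2 else 0)"
proof -
  have "arcsine_int ([:1, 0, -1:] * (cheb_U m * cheb_U n))
      = ((if m + 1 = n + 1 then pi else 0) + (-1) * (if (m + 1) + (n + 1) = 0 then pi else 0)) / 2"
  proof (rule arcsine_int_product)
    fix t :: real
    have "poly ([:1, 0, -1:] * (cheb_U m * cheb_U n)) (cos t)
        = (sin t)\<^sup>2 * (poly (cheb_U m) (cos t) * poly (cheb_U n) (cos t))"
      unfolding sin_squared_eq by (simp add: power2_eq_square algebra_simps)
    also have "\<dots> = sin (real (m + 1) * t) * sin (real (n + 1) * t)"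
      unfolding sin_times_cheb_U[symmetric] by (simp only: power2_eq_square mult_ac)
    also have "\<dots> = (cos ((real (m + 1) - real (n + 1)) * t)
        + (-1) * cos ((real (m + 1) + real (n + 1)) * t)) / 2"
      by (simp add: sin_times_sin left_diff_distrib distrib_right)
    finally show "poly ([:1, 0, -1:] * (cheb_U m * cheb_U n)) (cos t)
        = (cos ((real (m + 1) - real (n + 1)) * t)
        + (-1) * cos ((real (m + 1) + real (n + 1)) * t)) / 2" .
  qed
  then show ?thesis by (auto simp del: mult_pCons_left)
qed

interpretation U: chebyshev_family cheb_U 2 "[:1, 0, -1:]"
proof
  show "cheb_U 0 = 1" "cheb_U (Suc 0) = [:0, 2:]"
    by (rule cheb_U_eqI; simp add: sin_double)+
  show "cheb_U (Suc (Suc n)) = [:0, 2:] * cheb_U (Suc n) - cheb_U n" for n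
  proof (rule cheb_U_eqI)
    fix x :: real
    have "sin (real (Suc (Suc n) + 1) * x) = sin (real (Suc n + 1) * x + x)"
      and "sin (real (n + 1) * x) = sin (real (Suc n + 1) * x - x)"
      by (simp_all add: algebra_simps)
    then have "sin (real (Suc (Suc n) + 1) * x)
        = 2 * cos x * sin (real (Suc n + 1) * x) - sin (real (n + 1) * x)"
      by (simp only: sin_add sin_diff) (simp only: algebra_simps)
    then show "sin x * poly ([:0, 2:] * cheb_U (Suc n) - cheb_U n) (cos x)
        = sin (real (Suc (Suc n) + 1) * x)"
      unfolding sin_times_cheb_U[symmetric] by (simp add: algebra_simps)
  qed
qed (simp_all add: arcsine_int_cheb_U_product power2_eq_square del: mult_pCons_left)

lemma arcsine_int_cheb_U_weight: "arcsine_int [:1, 0, -1:] = pi / 2"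
  using arcsine_int_cheb_U_product[of 0 0] by (simp add: U.p_0)

theorem theorem1p4:
  fixes n :: nat
  assumes "n > 0"
  shows "((\<lambda>x::real. ((poly (cheb_T n) x - poly (cheb_T n) 0) / x)\<^sup>2 / sqrt (1 - x\<^sup>2))
            has_integral pi * real n) {-1..1}
       \<and> ((\<lambda>x::real. ((poly (cheb_U n) x - poly (cheb_U n) 0) / x)\<^sup>2 * sqrt (1 - x\<^sup>2))
            has_integral (if even n then pi * real n else pi * real (n + 1))) {-1..1}"
proof
  have "(if even n then pi * real n else pi * (real n - 1) + 1\<^sup>2 * arcsine_int 1) = pi * real n"
    by (simp add: algebra_simps)
  then show "((\<lambda>x::real. ((poly (cheb_T n) x - poly (cheb_T n) 0) / x)\<^sup>2 / sqrt (1 - x\<^sup>2))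
      has_integral pi * real n) {-1..1}"
    using T.has_integral_difference_quotient[of n] by simp
next
  have integral_value: "(if even n then pi * real n else pi * (real n - 1) + 2\<^sup>2 * arcsine_int [:1, 0, -1:])
      = (if even n then pi * real n else pi * real (n + 1))"
    by (simp add: arcsine_int_cheb_U_weight algebra_simps)
  \<comment> \<open>This includes the end points, where the left side is \<open>0\<close> by the convention on division by zero.\<close>
  have weight: "poly [:1, 0, -1:] x / sqrt (1 - x\<^sup>2) = sqrt (1 - x\<^sup>2)" if "x \<in> {-1..1}" for x :: real
  proof -
    have "0 \<le> 1 - x\<^sup>2"
      using that by (simp add: abs_square_le_1 abs_le_iff)
    then have "(1 - x\<^sup>2) / sqrt (1 - x\<^sup>2) = sqrt (1 - x\<^sup>2)"
      by (rule real_div_sqrt)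
    then show ?thesis
      by (simp add: power2_eq_square)
  qed
  show "((\<lambda>x::real. ((poly (cheb_U n) x - poly (cheb_U n) 0) / x)\<^sup>2 * sqrt (1 - x\<^sup>2))
      has_integral (if even n then pi * real n else pi * real (n + 1))) {-1..1}"
    by (rule has_integral_eq[OF _ U.has_integral_difference_quotient[of n, unfolded integral_value]])
       (simp only: weight)
qed

end
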